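(* Suppose $Q$ is a directed set that is a countable union of $\omega_1$-directed sets. Then $\langle\mathcal U,\supseteq\rangle\not\leq_T Q$ for every nonprincipal ultrafilter $\mathcal U$ on $\omega$ satisfying $\operatorname{cf}(\operatorname{cf}(\langle\mathcal U,\supseteq\rangle))>\omega$.
   Context: A quasiorder is a set with a reflexive transitive relation $\leq$. A quasiorder is $\kappa$-directed if every subset of size less than $\kappa$ has an upper bound in it; directed means $\omega$-directed. "$Q$ is a countable union of $\omega_1$-directed sets" means $Q=\bigcup_{n<\omega}Q_n$ where each $Q_n\subseteq Q$, with the order inherited from $Q$, is $\omega_1$-directed. A subset $C$ of a quasiorder $P$ is cofinal if every $p\in P$ satisfies $p\leq c$ for some $c\in C$; $\operatorname{cf}(P)$ is the least cardinality of a cofinal subset of $P$. In $\operatorname{cf}(\operatorname{cf}(\langle\mathcal U,\supseteq\rangle))$ the outer $\operatorname{cf}$ is the cofinality of the cardinal $\operatorname{cf}(\langle\mathcal U,\supseteq\rangle)$. For directed sets $P,Q$, a map $f\colon P\to Q$ is Tukey if the $f$-image of every unbounded subset of $P$ is unbounded in $Q$; $P\leq_T Q$ means a Tukey map $P\to Q$ exists. $\langle\mathcal U,\supseteq\rangle$ denotes $\mathcal U$ ordered so that $A\leq B$ iff $A\supseteq B$. *)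

theory Defs
  imports Main
begin

unbundle cardinal_syntax

text \<open>
  A quasiorder is a relation \<open>r\<close> with \<^term>\<open>Preorder r\<close>; its underlying set is \<^term>\<open>Field r\<close>,
  and \<^term>\<open>(p, q) \<in> r\<close> reads ``\<open>p\<close> is below \<open>q\<close>''. The order inherited by a subset \<open>A\<close> is
  \<^term>\<open>Restr r A\<close>. Cardinals are represented, as in the library, by
  well-order relations that are minimal for their size; \<^term>\<open>natLeq\<close> is the cardinal \<open>\<omega>\<close>.
\<close>

abbreviation omega1 :: "nat set rel" where
  "omega1 \<equiv> cardSuc natLeq"

definition bounded_in :: "'a rel \<Rightarrow> 'a set \<Rightarrow> bool" where
  "bounded_in r A \<longleftrightarrow> (\<exists>b \<in> Field r. \<forall>a \<in> A. (a, b) \<in> r)"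

definition kappa_directed :: "'k rel \<Rightarrow> 'a rel \<Rightarrow> bool" where
  "kappa_directed \<kappa> r \<longleftrightarrow>
     Preorder r \<and> (\<forall>A. A \<subseteq> Field r \<longrightarrow> |A| <o \<kappa> \<longrightarrow> bounded_in r A)"

abbreviation directed :: "'a rel \<Rightarrow> bool" where
  "directed r \<equiv> kappa_directed natLeq r"

definition cofinal_in :: "'a rel \<Rightarrow> 'a set \<Rightarrow> bool" where
  "cofinal_in r C \<longleftrightarrow> C \<subseteq> Field r \<and> (\<forall>p \<in> Field r. \<exists>c \<in> C. (p, c) \<in> r)"

text \<open>
  The least cardinality of a cofinal subset, as a cardinal. Since a cardinal is itself a
  (reflexive) well-order, \<open>cf\<close> can be applied to it again, which gives its cofinality as a cardinal.
\<close>
definition cf :: "'a rel \<Rightarrow> 'a rel" where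
  "cf r = |SOME C. cofinal_in r C \<and> (\<forall>D. cofinal_in r D \<longrightarrow> |C| \<le>o |D| )|"

lemma cf_least:
  assumes "Preorder r"
  shows "\<exists>C. cofinal_in r C \<and> cf r = |C|" and "cofinal_in r D \<Longrightarrow> cf r \<le>o |D|"
proof -
  let ?R = "{|C| | C. cofinal_in r C}"
  have "cofinal_in r (Field r)"
    using assms by (auto simp: cofinal_in_def preorder_on_def refl_on_def)
  then have "?R \<noteq> {}" by blast
  moreover have "\<forall>s \<in> ?R. Card_order s" using card_of_Card_order by blast
  ultimately have "\<exists>s \<in> ?R. \<forall>t \<in> ?R. s \<le>o t" by (rule exists_minim_Card_order)
  then have "\<exists>C. cofinal_in r C \<and> (\<forall>D. cofinal_in r D \<longrightarrow> |C| \<le>o |D| )" by blast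
  from someI_ex[OF this]
  show "\<exists>C. cofinal_in r C \<and> cf r = |C|" and "cofinal_in r D \<Longrightarrow> cf r \<le>o |D|"
    unfolding cf_def by blast+
qed

definition tukey_map :: "'a rel \<Rightarrow> 'b rel \<Rightarrow> ('a \<Rightarrow> 'b) \<Rightarrow> bool" where
  "tukey_map r s f \<longleftrightarrow>
     f ` Field r \<subseteq> Field s \<and>
     (\<forall>X. X \<subseteq> Field r \<longrightarrow> \<not> bounded_in r X \<longrightarrow> \<not> bounded_in s (f ` X))"

definition tukey_le :: "'a rel \<Rightarrow> 'b rel \<Rightarrow> bool" (infix "\<le>\<^sub>T" 50) where
  "r \<le>\<^sub>T s \<longleftrightarrow> (\<exists>f. tukey_map r s f)"

text \<open>
  Ultrafilters are represented by the library's type of filters, whose only improper member is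
  \<^term>\<open>bot\<close>; \<open>filter_sets\<close> recovers the family of sets.
\<close>

definition filter_sets :: "'a filter \<Rightarrow> 'a set set" where
  "filter_sets \<U> = {A. eventually (\<lambda>x. x \<in> A) \<U>}"

definition ultrafilter :: "'a filter \<Rightarrow> bool" where
  "ultrafilter \<U> \<longleftrightarrow> \<U> \<noteq> bot \<and> (\<forall>A. A \<in> filter_sets \<U> \<or> - A \<in> filter_sets \<U>)"

definition nonprincipal :: "'a filter \<Rightarrow> bool" where
  "nonprincipal \<U> \<longleftrightarrow> (\<forall>S. \<U> \<noteq> principal S)"

definition superset_order :: "'a filter \<Rightarrow> 'a set rel" where
  "superset_order \<U> = {(A, B). A \<in> filter_sets \<U> \<and> B \<in> filter_sets \<U> \<and> A \<supseteq> B}"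

lemma Field_superset_order: "Field (superset_order \<U>) = filter_sets \<U>"
  by (auto simp: superset_order_def Field_def)

lemma directed_superset_order: "directed (superset_order \<U>)"
proof -
  have "Preorder (superset_order \<U>)"
    unfolding Field_superset_order preorder_on_def
    by (auto simp: superset_order_def refl_on_def trans_def)
  moreover have "bounded_in (superset_order \<U>) \<A>"
    if "\<A> \<subseteq> filter_sets \<U>" and "|\<A>| <o natLeq" for \<A>
  proof -
    have "finite \<A>" using that(2) by (simp add: finite_iff_ordLess_natLeq)
    then have "\<Inter>\<A> \<in> filter_sets \<U>"
      using that(1) by (auto simp: filter_sets_def eventually_ball_finite_distrib subset_iff)
    then show ?thesis
      using that(1) unfolding bounded_in_def Field_superset_order
      by (auto simp: superset_order_def intro!: bexI[of _ "\<Inter>\<A>"])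
  qed
  ultimately show ?thesis by (simp add: kappa_directed_def Field_superset_order)
qed

end

theory Submission
  imports Defs
begin

text \<open>
  Let \<open>f\<close> be Tukey from \<open>\<langle>\<U>, \<supseteq>\<rangle>\<close> to \<open>Q = \<Union>n. S n\<close>. Countably many members of \<open>\<U>\<close>
  whose images lie in one \<open>S n\<close> have bounded image, so they have a common lower bound in \<open>\<U>\<close>.
  On \<open>\<omega>\<close> an arbitrary intersection equals a countable one, because each excluded point needs only
  one witness; hence the intersection \<open>X n\<close> of \<^emph>\<open>all\<close> members of \<open>\<U>\<close> mapped into \<open>S n\<close> is itself
  in \<open>\<U>\<close>. Then \<open>{X n | n}\<close> is a countable base of \<open>\<U>\<close>, so \<open>\<U>\<close> has countable cofinality.
\<close>

lemma tukey_mapD_bounded: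
  assumes "tukey_map r s f" and "X \<subseteq> Field r" and "bounded_in s (f ` X)"
  shows "bounded_in r X"
  using assms unfolding tukey_map_def by blast

text \<open>An upper bound for reverse inclusion is a member of \<open>F\<close> inside every set of
  the family, so upward closure puts the intersection in \<open>F\<close>; conversely the
  intersection itself is a bound.\<close>

lemma bounded_in_superset_order_iff:
  assumes "\<A> \<subseteq> filter_sets F"
  shows "bounded_in (superset_order F) \<A> \<longleftrightarrow> \<Inter>\<A> \<in> filter_sets F"
proof
  assume "bounded_in (superset_order F) \<A>"
  then obtain B where "B \<in> filter_sets F" and "B \<subseteq> \<Inter>\<A>"
    unfolding bounded_in_def Field_superset_order by (auto simp: superset_order_def)
  then show "\<Inter>\<A> \<in> filter_sets F"
    unfolding filter_sets_def by (auto elim!: eventually_mono)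
next
  assume "\<Inter>\<A> \<in> filter_sets F"
  then show "bounded_in (superset_order F) \<A>"
    using assms unfolding bounded_in_def Field_superset_order
    by (auto simp: superset_order_def intro!: bexI[of _ "\<Inter>\<A>"])
qed

lemma countable_subfamily_same_Inter:
  fixes \<A> :: "nat set set"
  obtains \<B> where "\<B> \<subseteq> \<A>" and "|\<B>| \<le>o natLeq" and "\<Inter>\<B> = \<Inter>\<A>"
proof -
  have "\<forall>k \<in> - \<Inter>\<A>. \<exists>A \<in> \<A>. k \<notin> A" by blast
  then obtain W where W: "\<And>k. k \<in> - \<Inter>\<A> \<Longrightarrow> W k \<in> \<A> \<and> k \<notin> W k"
    by metis
  \<comment> \<open>One witness per excluded point: indexing by naturals keeps the family countable,
    and every excluded point stays excluded.\<close>
  let ?B = "W ` (- \<Inter>\<A>)"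
  have "|?B| \<le>o |UNIV :: nat set|"
    by (rule ordLeq_transitive[OF card_of_image card_of_mono1[OF subset_UNIV]])
  then have "|?B| \<le>o natLeq"
    by (rule ordLeq_ordIso_trans[OF _ card_of_nat])
  moreover have "?B \<subseteq> \<A>" using W by blast
  moreover have "\<Inter>?B = \<Inter>\<A>"
  proof
    show "\<Inter>\<A> \<subseteq> \<Inter>?B" using W by blast
    show "\<Inter>?B \<subseteq> \<Inter>\<A>" using W by (meson ComplI INT_E subsetI)
  qed
  ultimately show thesis by (intro that)
qed

text \<open>Reflexivity keeps each point of \<open>A\<close> related to itself after
  restriction.\<close>

lemma Field_Restr_Preorder:
  assumes "Preorder r" and "A \<subseteq> Field r"
  shows "Field (Restr r A) = A"
  using assms by (auto simp: Field_def preorder_on_def refl_on_def)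

lemma omega1_directed_bounded_in:
  assumes "Preorder r" and "A \<subseteq> Field r" and "kappa_directed omega1 (Restr r A)"
    and "X \<subseteq> A" and "|X| \<le>o natLeq"
  shows "bounded_in r X"
proof -
  have "|X| <o omega1"
    by (rule ordLeq_ordLess_trans[OF assms(5) cardSuc_greater[OF natLeq_Card_order]])
  then have "bounded_in (Restr r A) X"
    using assms(3,4) Field_Restr_Preorder[OF assms(1,2)] unfolding kappa_directed_def by blast
  then show ?thesis
    unfolding bounded_in_def Field_Restr_Preorder[OF assms(1,2)] using assms(2) by blast
qed

text \<open>Directedness of \<open>A\<close> bounds only countable images, so the Tukey property is
  applied to a countable subfamily with the same intersection.\<close>

lemma tukey_omega1_directed_Inter:
  fixes F :: "nat filter"
  assumes "tukey_map (superset_order F) Q f" and "Preorder Q"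
    and "A \<subseteq> Field Q" and "kappa_directed omega1 (Restr Q A)"
    and "\<A> \<subseteq> filter_sets F" and "f ` \<A> \<subseteq> A"
  shows "\<Inter>\<A> \<in> filter_sets F"
proof -
  obtain \<B> where B: "\<B> \<subseteq> \<A>" "|\<B>| \<le>o natLeq" "\<Inter>\<B> = \<Inter>\<A>"
    by (rule countable_subfamily_same_Inter)
  have "|f ` \<B>| \<le>o natLeq"
    by (rule ordLeq_transitive[OF card_of_image B(2)])
  moreover have "f ` \<B> \<subseteq> A" using B(1) assms(6) by (meson image_mono order_trans)
  ultimately have "bounded_in Q (f ` \<B>)"
    by (intro omega1_directed_bounded_in[OF assms(2,3,4)])
  moreover have sub: "\<B> \<subseteq> filter_sets F" using B(1) assms(5) by (rule order_trans)
  ultimately have "bounded_in (superset_order F) \<B>"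
    by (intro tukey_mapD_bounded[OF assms(1)]) (simp_all add: Field_superset_order)
  then show ?thesis
    unfolding bounded_in_superset_order_iff[OF sub] B(3) .
qed

lemma tukey_countable_cf:
  fixes F :: "nat filter"
  assumes "superset_order F \<le>\<^sub>T Q" and "Preorder Q" and "Field Q = (\<Union>n::nat. S n)"
    and "\<And>n. kappa_directed omega1 (Restr Q (S n))"
  shows "cf (superset_order F) \<le>o natLeq"
proof -
  obtain f where f: "tukey_map (superset_order F) Q f"
    using assms(1) unfolding tukey_le_def by blast
  \<comment> \<open>If no member of \<open>F\<close> is mapped into \<open>S n\<close>, then
    \<open>X n\<close> is \<open>UNIV\<close>, which still lies in \<open>F\<close>.\<close>
  define X where "X n = \<Inter>{A \<in> filter_sets F. f A \<in> S n}" for n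
  have X: "X n \<in> filter_sets F" for n
    unfolding X_def using assms(3)
    by (intro tukey_omega1_directed_Inter[OF f assms(2) _ assms(4)]) auto
  have "\<exists>n. (A, X n) \<in> superset_order F" if A: "A \<in> filter_sets F" for A
  proof -
    have "f A \<in> Field Q"
      using f A by (auto simp: tukey_map_def Field_superset_order)
    then obtain n where "f A \<in> S n" using assms(3) by blast
    then have "X n \<subseteq> A" using A by (auto simp: X_def)
    then show ?thesis using A X by (auto simp: superset_order_def)
  qed
  then have "cofinal_in (superset_order F) (range X)"
    unfolding cofinal_in_def Field_superset_order using X by blast
  moreover have "Preorder (superset_order F)"
    using directed_superset_order unfolding kappa_directed_def by blast
  ultimately have "cf (superset_order F) \<le>o |range X|" by (intro cf_least(2))
  also have "|range X| \<le>o |UNIV :: nat set|" by (rule card_of_image)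
  also have "|UNIV :: nat set| =o natLeq" by (rule card_of_nat)
  finally show ?thesis .
qed

text \<open>The whole field is cofinal by reflexivity, and the field of a cardinal has that cardinal
  as its size.\<close>

lemma cf_Card_order_le:
  assumes "Card_order r"
  shows "cf r \<le>o r"
proof -
  have pre: "Preorder r"
    using assms by (simp add: card_order_on_def well_order_on_def linear_order_on_def
        partial_order_on_def)
  then have "cofinal_in r (Field r)"
    by (auto simp: cofinal_in_def preorder_on_def refl_on_def)
  from cf_least(2)[OF pre this] show ?thesis
    by (rule ordLeq_ordIso_trans[OF _ card_of_Field_ordIso[OF assms]])
qed

lemma Card_order_cf: "Card_order (cf r)"
  unfolding cf_def by (rule card_of_Card_order)

theorem theorem3p16:
  fixes Q :: "'a rel"
    and S :: "nat \<Rightarrow> 'a set"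
    and \<U> :: "nat filter"
  assumes "directed Q"
    and "Field Q = (\<Union>n. S n)"
    and "\<And>n. kappa_directed omega1 (Restr Q (S n))"
    and "ultrafilter \<U>"
    and "nonprincipal \<U>"
    and "natLeq <o cf (cf (superset_order \<U>))"
  shows "\<not> superset_order \<U> \<le>\<^sub>T Q"
proof
  assume "superset_order \<U> \<le>\<^sub>T Q"
  moreover have "Preorder Q" using assms(1) unfolding kappa_directed_def by blast
  ultimately have "cf (superset_order \<U>) \<le>o natLeq"
    using assms(2,3) by (rule tukey_countable_cf)
  \<comment> \<open>Taking the cofinality of a cardinal cannot increase it, so the countable bound
    passes to the outer \<open>cf\<close>.\<close>
  then have "cf (cf (superset_order \<U>)) \<le>o natLeq"
    by (rule ordLeq_transitive[OF cf_Card_order_le[OF Card_order_cf]])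
  then show False using assms(6) by (simp add: not_ordLess_ordLeq)
qed

end
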